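(* Let $A$ be a Jacobi-Jordan (JJ) algebra over a field $k$, $E$ a vector space and $\pi:E\to A$ a linear epimorphism of vector spaces with $V=\mathrm{Ker}(\pi)$. Then the cohomologous relation $\approx$ is an equivalence relation on the set $\mathcal{CS}(A,V)$ of all crossed systems of $A$ by $V$. If we denote $\mathbb{GH}^2(A,V):=\mathcal{CS}(A,V)/\approx$, then the map $$\mathbb{GH}^2(A,V)\to \mathrm{Gext}(A,E),\qquad \overline{(\triangleright,\vartheta,\cdot_V)}\longmapsto A\#_{(\triangleright,\vartheta,\cdot_V)}V$$ is bijective, where $\overline{(\triangleright,\vartheta,\cdot_V)}$ denotes the equivalence class of $(\triangleright,\vartheta,\cdot_V)$ via $\approx$.
   Context: $k$ is an arbitrary field. A JJ algebra is a $k$-vector space $A$ with a bilinear map $\cdot:A\times A\to A$ such that $a\cdot b=b\cdot a$ and $a\cdot(b\cdot c)+b\cdot(c\cdot a)+c\cdot(a\cdot b)=0$; morphisms are multiplicative linear maps. Crossed systems: a crossed system of $A$ by $V$ is a triple $(\triangleright,\vartheta,\cdot_V)$ of bilinear maps $\triangleright:A\times V\to V$, $\vartheta:A\times A\to V$, $\cdot_V:V\times V\to V$ such that $A\times V$ with multiplication $(a,x)\bullet(b,y):=(a\cdot b,\ \vartheta(a,b)+a\triangleright y+b\triangleright x+x\cdot_V y)$ is a JJ algebra, called the crossed product $A\#_{(\triangleright,\vartheta,\cdot_V)}V$. Two crossed systems are cohomologous, $(\triangleright,\vartheta,\cdot_V)\approx(\triangleright',\vartheta',\cdot_V')$, if $\cdot_V=\cdot_V'$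 and there is a linear map $r:A\to V$ with $a\triangleright x=a\triangleright' x+r(a)\cdot_V' x$ and $\vartheta(a,b)=\vartheta'(a,b)+a\triangleright' r(b)+b\triangleright' r(a)+r(a)\cdot_V' r(b)-r(a\cdot b)$ for all $a,b\in A$, $x\in V$. $\mathrm{Gext}(A,E)$: two JJ algebra structures $\cdot,\cdot'$ on $E$ for which $\pi:E\to A$ is a JJ algebra morphism are cohomologous if there is a JJ algebra map $\varphi:(E,\cdot)\to(E,\cdot')$ with $\varphi(x)=x$ for all $x\in V$ and $\pi\circ\varphi=\pi$; this is an equivalence relation, and $\mathrm{Gext}(A,E)$ is the set of equivalence classes. A crossed product $A\#V$ is regarded as an element of $\mathrm{Gext}(A,E)$ by transporting its multiplication to $E$ along a linear isomorphism $\varphi_s:A\times V\to E$, $\varphi_s(a,x)=s(a)+x$, where $s:A\to E$ is any linear section of $\pi$ (the resulting class does not depend on $s$). *)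

theory Defs
  imports "HOL-Library.FuncSet" "HOL-Analysis.Product_Vector"
begin

text \<open>
  Vector spaces over a field \<open>'k\<close> are given by a type with a scaling operation
  (locale \<^locale>\<open>vector_space\<close>). The kernel \<open>V\<close> of \<open>\<pi>\<close> and the product \<open>A \<times> V\<close> are
  subspaces of such types, so bilinear maps and algebras are relative to carrier sets.
\<close>

definition bilinear_on ::
  "('k::field \<Rightarrow> 'a::ab_group_add \<Rightarrow> 'a) \<Rightarrow> 'a set \<Rightarrow>
   ('k \<Rightarrow> 'b::ab_group_add \<Rightarrow> 'b) \<Rightarrow> 'b set \<Rightarrow>
   ('k \<Rightarrow> 'c::ab_group_add \<Rightarrow> 'c) \<Rightarrow> 'c set \<Rightarrow> ('a \<Rightarrow> 'b \<Rightarrow> 'c) \<Rightarrow> bool" where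
  "bilinear_on s1 S1 s2 S2 s3 S3 f \<longleftrightarrow>
     (\<forall>x\<in>S1. \<forall>y\<in>S2. f x y \<in> S3) \<and>
     (\<forall>x\<in>S1. \<forall>x'\<in>S1. \<forall>y\<in>S2. f (x + x') y = f x y + f x' y) \<and>
     (\<forall>x\<in>S1. \<forall>y\<in>S2. \<forall>y'\<in>S2. f x (y + y') = f x y + f x y') \<and>
     (\<forall>c. \<forall>x\<in>S1. \<forall>y\<in>S2. f (s1 c x) y = s3 c (f x y)) \<and>
     (\<forall>c. \<forall>x\<in>S1. \<forall>y\<in>S2. f x (s2 c y) = s3 c (f x y))"

locale jj_algebra = vector_space scale
  for scale :: "'k::field \<Rightarrow> 'a::ab_group_add \<Rightarrow> 'a" +
  fixes S :: "'a set" and mult :: "'a \<Rightarrow> 'a \<Rightarrow> 'a"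
  assumes subspace_carrier: "subspace S"
    and bilinear_mult: "bilinear_on scale S scale S scale S mult"
    and mult_commute: "a \<in> S \<Longrightarrow> b \<in> S \<Longrightarrow> mult a b = mult b a"
    and jacobi: "a \<in> S \<Longrightarrow> b \<in> S \<Longrightarrow> c \<in> S \<Longrightarrow>
      mult a (mult b c) + mult b (mult c a) + mult c (mult a b) = 0"

definition jj_hom ::
  "('k::field \<Rightarrow> 'a::ab_group_add \<Rightarrow> 'a) \<Rightarrow> ('a \<Rightarrow> 'a \<Rightarrow> 'a) \<Rightarrow>
   ('k \<Rightarrow> 'b::ab_group_add \<Rightarrow> 'b) \<Rightarrow> ('b \<Rightarrow> 'b \<Rightarrow> 'b) \<Rightarrow> ('a \<Rightarrow> 'b) \<Rightarrow> bool" where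
  "jj_hom s1 m1 s2 m2 f \<longleftrightarrow>
     Vector_Spaces.linear s1 s2 f \<and> (\<forall>x y. f (m1 x y) = m2 (f x) (f y))"

abbreviation Ker :: "('e \<Rightarrow> 'a::zero) \<Rightarrow> 'e set" where
  "Ker \<pi> \<equiv> {x. \<pi> x = 0}"

type_synonym ('a, 'e) system =
  "('a \<Rightarrow> 'e \<Rightarrow> 'e) \<times> ('a \<Rightarrow> 'a \<Rightarrow> 'e) \<times> ('e \<Rightarrow> 'e \<Rightarrow> 'e)"

fun crossed_mult ::
  "('a \<Rightarrow> 'a \<Rightarrow> 'a) \<Rightarrow> ('a, 'e::plus) system \<Rightarrow> 'a \<times> 'e \<Rightarrow> 'a \<times> 'e \<Rightarrow> 'a \<times> 'e" where
  "crossed_mult mA (act, \<theta>, mV) (a, x) (b, y) =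
     (mA a b, \<theta> a b + act a y + act b x + mV x y)"

text \<open>
  Arguments ranging over \<open>V\<close> are extensional (\<open>\<rightarrow>\<^sub>E\<close>), so that equality of triples is equality
  of maps on \<open>A \<times> V\<close>, \<open>A \<times> A\<close> and \<open>V \<times> V\<close>; values outside \<open>V\<close> carry no information.
\<close>

definition crossed_systems ::
  "('k::field \<Rightarrow> 'a::ab_group_add \<Rightarrow> 'a) \<Rightarrow> ('a \<Rightarrow> 'a \<Rightarrow> 'a) \<Rightarrow>
   ('k \<Rightarrow> 'e::ab_group_add \<Rightarrow> 'e) \<Rightarrow> 'e set \<Rightarrow> ('a, 'e) system set" where
  "crossed_systems sA mA sE V =
     {(act, \<theta>, mV).
        act \<in> UNIV \<rightarrow>\<^sub>E V \<rightarrow>\<^sub>E V \<and> bilinear_on sA UNIV sE V sE V act \<and>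
        \<theta> \<in> UNIV \<rightarrow>\<^sub>E UNIV \<rightarrow>\<^sub>E V \<and> bilinear_on sA UNIV sA UNIV sE V \<theta> \<and>
        mV \<in> V \<rightarrow>\<^sub>E V \<rightarrow>\<^sub>E V \<and> bilinear_on sE V sE V sE V mV \<and>
        jj_algebra (module_prod.scale sA sE) (UNIV \<times> V) (crossed_mult mA (act, \<theta>, mV))}"

definition cohomologous ::
  "('k::field \<Rightarrow> 'a::ab_group_add \<Rightarrow> 'a) \<Rightarrow> ('a \<Rightarrow> 'a \<Rightarrow> 'a) \<Rightarrow>
   ('k \<Rightarrow> 'e::ab_group_add \<Rightarrow> 'e) \<Rightarrow> 'e set \<Rightarrow> (('a, 'e) system \<times> ('a, 'e) system) set" where
  "cohomologous sA mA sE V =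
     {((act, \<theta>, mV), (act', \<theta>', mV')).
        (act, \<theta>, mV) \<in> crossed_systems sA mA sE V \<and>
        (act', \<theta>', mV') \<in> crossed_systems sA mA sE V \<and>
        mV = mV' \<and>
        (\<exists>r. Vector_Spaces.linear sA sE r \<and> range r \<subseteq> V \<and>
          (\<forall>a. \<forall>x\<in>V. act a x = act' a x + mV' (r a) x) \<and>
          (\<forall>a b. \<theta> a b = \<theta>' a b + act' a (r b) + act' b (r a) + mV' (r a) (r b) - r (mA a b)))}"

definition GH2 ::
  "('k::field \<Rightarrow> 'a::ab_group_add \<Rightarrow> 'a) \<Rightarrow> ('a \<Rightarrow> 'a \<Rightarrow> 'a) \<Rightarrow>
   ('k \<Rightarrow> 'e::ab_group_add \<Rightarrow> 'e) \<Rightarrow> 'e set \<Rightarrow> ('a, 'e) system set set" where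
  "GH2 sA mA sE V = crossed_systems sA mA sE V // cohomologous sA mA sE V"

definition jj_structures ::
  "('k::field \<Rightarrow> 'a::ab_group_add \<Rightarrow> 'a) \<Rightarrow> ('a \<Rightarrow> 'a \<Rightarrow> 'a) \<Rightarrow>
   ('k \<Rightarrow> 'e::ab_group_add \<Rightarrow> 'e) \<Rightarrow> ('e \<Rightarrow> 'a) \<Rightarrow> ('e \<Rightarrow> 'e \<Rightarrow> 'e) set" where
  "jj_structures sA mA sE \<pi> = {m. jj_algebra sE UNIV m \<and> jj_hom sE m sA mA \<pi>}"

definition ext_cohomologous ::
  "('k::field \<Rightarrow> 'a::ab_group_add \<Rightarrow> 'a) \<Rightarrow> ('a \<Rightarrow> 'a \<Rightarrow> 'a) \<Rightarrow>
   ('k \<Rightarrow> 'e::ab_group_add \<Rightarrow> 'e) \<Rightarrow> ('e \<Rightarrow> 'a) \<Rightarrow>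
   (('e \<Rightarrow> 'e \<Rightarrow> 'e) \<times> ('e \<Rightarrow> 'e \<Rightarrow> 'e)) set" where
  "ext_cohomologous sA mA sE \<pi> =
     {(m, m'). m \<in> jj_structures sA mA sE \<pi> \<and> m' \<in> jj_structures sA mA sE \<pi> \<and>
        (\<exists>\<phi>. jj_hom sE m sE m' \<phi> \<and> (\<forall>x\<in>Ker \<pi>. \<phi> x = x) \<and> \<pi> \<circ> \<phi> = \<pi>)}"

definition Gext ::
  "('k::field \<Rightarrow> 'a::ab_group_add \<Rightarrow> 'a) \<Rightarrow> ('a \<Rightarrow> 'a \<Rightarrow> 'a) \<Rightarrow>
   ('k \<Rightarrow> 'e::ab_group_add \<Rightarrow> 'e) \<Rightarrow> ('e \<Rightarrow> 'a) \<Rightarrow> ('e \<Rightarrow> 'e \<Rightarrow> 'e) set set" where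
  "Gext sA mA sE \<pi> = jj_structures sA mA sE \<pi> // ext_cohomologous sA mA sE \<pi>"

definition linear_sections ::
  "('k::field \<Rightarrow> 'a::ab_group_add \<Rightarrow> 'a) \<Rightarrow> ('k \<Rightarrow> 'e::ab_group_add \<Rightarrow> 'e) \<Rightarrow>
   ('e \<Rightarrow> 'a) \<Rightarrow> ('a \<Rightarrow> 'e) set" where
  "linear_sections sA sE \<pi> = {s. Vector_Spaces.linear sA sE s \<and> \<pi> \<circ> s = id}"

fun section_iso :: "('a \<Rightarrow> 'e::plus) \<Rightarrow> 'a \<times> 'e \<Rightarrow> 'e" where
  "section_iso s (a, x) = s a + x"

definition transported_mult ::
  "('a::ab_group_add \<Rightarrow> 'a \<Rightarrow> 'a) \<Rightarrow> ('e::ab_group_add \<Rightarrow> 'a) \<Rightarrow> ('a \<Rightarrow> 'e) \<Rightarrow>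
   ('a, 'e) system \<Rightarrow> 'e \<Rightarrow> 'e \<Rightarrow> 'e" where
  "transported_mult mA \<pi> s c u v =
     section_iso s (crossed_mult mA c
       (inv_into (UNIV \<times> Ker \<pi>) (section_iso s) u)
       (inv_into (UNIV \<times> Ker \<pi>) (section_iso s) v))"

text \<open>
  The union runs over all representatives \<open>c\<close> of the class \<open>C\<close> and all linear sections \<open>s\<close>;
  independence of both choices means that it is a single equivalence class.
\<close>

definition GH2_to_Gext ::
  "('k::field \<Rightarrow> 'a::ab_group_add \<Rightarrow> 'a) \<Rightarrow> ('a \<Rightarrow> 'a \<Rightarrow> 'a) \<Rightarrow>
   ('k \<Rightarrow> 'e::ab_group_add \<Rightarrow> 'e) \<Rightarrow> ('e \<Rightarrow> 'a) \<Rightarrow>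
   ('a, 'e) system set \<Rightarrow> ('e \<Rightarrow> 'e \<Rightarrow> 'e) set" where
  "GH2_to_Gext sA mA sE \<pi> C =
     (\<Union>c\<in>C. \<Union>s\<in>linear_sections sA sE \<pi>.
        ext_cohomologous sA mA sE \<pi> `` {transported_mult mA \<pi> s c})"

end

theory Submission
  imports Defs
begin

text \<open>
  A linear section \<open>s\<close> of \<open>\<pi>\<close> identifies \<open>A \<times> V\<close> with \<open>E\<close>, and under this identification every
  admissible multiplication on \<open>E\<close> is a crossed product, with \<open>a \<triangleright> x = s a \<cdot> x\<close> and
  \<open>\<vartheta>(a, b) = s a \<cdot> s b - s (a \<cdot> b)\<close>. A linear map \<open>\<phi>\<close> that fixes \<open>V\<close> and lies over \<open>A\<close> has the form
  \<open>\<phi> (s a + x) = s' a + r a + x\<close> with \<open>r : A \<rightarrow> V\<close> linear, and it is multiplicative precisely when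
  \<open>r\<close> satisfies the equations of the cohomologous relation. Hence that relation is the pullback of
  the equivalence of extensions.
\<close>

section \<open>Bilinear maps and transport of the Jacobi-Jordan axioms\<close>

lemma bilinear_onD:
  assumes "bilinear_on s1 S1 s2 S2 s3 S3 f" and "x \<in> S1" and "y \<in> S2"
  shows "f x y \<in> S3"
    and "x' \<in> S1 \<Longrightarrow> f (x + x') y = f x y + f x' y"
    and "y' \<in> S2 \<Longrightarrow> f x (y + y') = f x y + f x y'"
    and "f (s1 c x) y = s3 c (f x y)"
    and "f x (s2 c y) = s3 c (f x y)"
  using assms unfolding bilinear_on_def by blast+

lemma bilinear_on_zero:
  assumes f: "bilinear_on s1 S1 s2 S2 s3 S3 f"
  shows "0 \<in> S1 \<Longrightarrow> y \<in> S2 \<Longrightarrow> f 0 y = 0" and "0 \<in> S2 \<Longrightarrow> x \<in> S1 \<Longrightarrow> f x 0 = 0"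
  using bilinear_onD(2)[OF f, of 0 y 0] bilinear_onD(3)[OF f, of x 0 0] by simp_all

text \<open>Injectivity of \<open>f\<close> on \<open>S2\<close> allows each axiom to be checked
  after applying \<open>f\<close>, where it becomes an axiom of \<open>m1\<close>. This serves both
  directions of the correspondence, with \<open>f\<close> equal to \<open>split s\<close> and to
  \<open>section_iso s\<close>.\<close>

lemma jj_algebra_transfer:
  assumes jj: "jj_algebra s1 S1 m1"
    and lin: "Vector_Spaces.linear s2 s1 f"
    and sub: "module.subspace s2 S2"
    and img: "\<And>x. x \<in> S2 \<Longrightarrow> f x \<in> S1"
    and inj: "inj_on f S2"
    and closed: "\<And>x y. x \<in> S2 \<Longrightarrow> y \<in> S2 \<Longrightarrow> m2 x y \<in> S2"
    and hom: "\<And>x y. x \<in> S2 \<Longrightarrow> y \<in> S2 \<Longrightarrow> f (m2 x y) = m1 (f x) (f y)"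
  shows "jj_algebra s2 S2 m2"
proof -
  interpret source: jj_algebra s1 S1 m1 by (rule jj)
  interpret f: Vector_Spaces.linear s2 s1 f by (rule lin)
  note bil = bilinear_onD[OF source.bilinear_mult]
  note cl = closed f.vs1.subspace_add[OF sub] f.vs1.subspace_scale[OF sub]
  note fs = f.add f.scale hom img cl
  show ?thesis
  proof unfold_locales
    show "f.vs1.subspace S2" by (rule sub)
    show "bilinear_on s2 S2 s2 S2 s2 S2 m2"
      unfolding bilinear_on_def
      by (intro conjI ballI allI; (rule inj_onD[OF inj])?) (simp_all add: fs bil)
    show "m2 a b = m2 b a" if "a \<in> S2" "b \<in> S2" for a b
      by (rule inj_onD[OF inj]) (use that in \<open>simp_all add: fs source.mult_commute\<close>)
    show "m2 a (m2 b c) + m2 b (m2 c a) + m2 c (m2 a b) = 0"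
      if "a \<in> S2" "b \<in> S2" "c \<in> S2" for a b c
      by (rule inj_onD[OF inj])
        (use that f.vs1.subspace_0[OF sub] in \<open>simp_all add: fs f.zero source.jacobi\<close>)
  qed
qed

section \<open>Linear sections and the identification of A x V with E\<close>

locale epimorphism_onto_jj_algebra =
  A: jj_algebra scaleA UNIV multA + pi: Vector_Spaces.linear scaleE scaleA \<pi>
  for scaleA :: "'k::field \<Rightarrow> 'a::ab_group_add \<Rightarrow> 'a"
    and multA :: "'a \<Rightarrow> 'a \<Rightarrow> 'a"
    and scaleE :: "'k \<Rightarrow> 'e::ab_group_add \<Rightarrow> 'e"
    and \<pi> :: "'e \<Rightarrow> 'a" +
  assumes surj_pi: "surj \<pi>"
begin

sublocale AE: vector_space_prod scaleA scaleE ..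

abbreviation "CS \<equiv> crossed_systems scaleA multA scaleE (Ker \<pi>)"
abbreviation "coh \<equiv> cohomologous scaleA multA scaleE (Ker \<pi>)"
abbreviation "ext_coh \<equiv> ext_cohomologous scaleA multA scaleE \<pi>"
abbreviation "structures \<equiv> jj_structures scaleA multA scaleE \<pi>"
abbreviation "sections \<equiv> linear_sections scaleA scaleE \<pi>"

text \<open>The explicit inverse of \<open>section_iso s\<close> for a section \<open>s\<close>; it
  replaces the \<open>inv_into\<close> inside \<open>transported_mult\<close>.\<close>

definition split :: "('a \<Rightarrow> 'e) \<Rightarrow> 'e \<Rightarrow> 'a \<times> 'e" where
  "split s u = (\<pi> u, u - s (\<pi> u))"

text \<open>The second component is the factor set: it measures the failure of \<open>s\<close> to
  be multiplicative. Arguments from \<open>Ker \<pi>\<close> are restricted to make the maps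
  extensional, as \<open>crossed_systems\<close> demands.\<close>

definition system_of :: "('a \<Rightarrow> 'e) \<Rightarrow> ('e \<Rightarrow> 'e \<Rightarrow> 'e) \<Rightarrow> ('a, 'e) system" where
  "system_of s m =
     (\<lambda>a. \<lambda>x\<in>Ker \<pi>. m (s a) x,
      \<lambda>a b. m (s a) (s b) - s (multA a b),
      \<lambda>x\<in>Ker \<pi>. \<lambda>y\<in>Ker \<pi>. m x y)"

text \<open>A surjective linear map of vector spaces splits. Without a section the union in
  \<open>GH2_to_Gext\<close> would be empty.\<close>

lemma sections_nonempty: "sections \<noteq> {}"
proof -
  interpret EA: vector_space_pair scaleE scaleA ..
  show ?thesis
    using EA.linear_surjective_right_inverse[OF pi.linear_axioms surj_pi]
    by (auto simp: linear_sections_def)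
qed

lemma subspace_Ker: "pi.vs1.subspace (Ker \<pi>)"
  by (rule pi.subspace_kernel)

lemmas pi_simps = pi.add pi.diff pi.zero pi.scale pi.neg

lemma sectionD:
  assumes "s \<in> sections"
  shows "Vector_Spaces.linear scaleA scaleE s"
    and "\<pi> (s a) = a"
    and "s (a + b) = s a + s b"
    and "s (a - b) = s a - s b"
    and "s (scaleA k a) = scaleE k (s a)"
    and "s 0 = 0"
proof -
  show lin: "Vector_Spaces.linear scaleA scaleE s"
    using assms by (simp add: linear_sections_def)
  then interpret s: Vector_Spaces.linear scaleA scaleE s .
  show "\<pi> (s a) = a"
    using assms by (simp add: linear_sections_def fun_eq_iff)
  show "s (a + b) = s a + s b" "s (a - b) = s a - s b" "s (scaleA k a) = scaleE k (s a)" "s 0 = 0"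
    by (simp_all add: s.add s.diff s.scale s.zero)
qed

lemma split_section_iso: "s \<in> sections \<Longrightarrow> \<pi> x = 0 \<Longrightarrow> split s (section_iso s (a, x)) = (a, x)"
  by (simp add: split_def pi.add sectionD)

lemma section_iso_split: "section_iso s (split s u) = u"
  by (simp add: split_def)

lemma split_in: "s \<in> sections \<Longrightarrow> split s u \<in> UNIV \<times> Ker \<pi>"
  by (simp add: split_def pi.diff sectionD)

lemma inj_on_section_iso: "s \<in> sections \<Longrightarrow> inj_on (section_iso s) (UNIV \<times> Ker \<pi>)"
  by (rule inj_on_inverseI[where g = "split s"]) (auto simp: split_section_iso simp del: section_iso.simps)

lemma inv_into_section_iso:
  assumes "s \<in> sections"
  shows "inv_into (UNIV \<times> Ker \<pi>) (section_iso s) u = split s u"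
  using inv_into_f_f[OF inj_on_section_iso[OF assms] split_in[OF assms], of u]
  by (simp add: section_iso_split)

lemma transported_mult_split:
  "s \<in> sections \<Longrightarrow> transported_mult multA \<pi> s c u v =
     section_iso s (crossed_mult multA c (split s u) (split s v))"
  by (simp add: transported_mult_def inv_into_section_iso)

lemma transported_mult_section_iso:
  assumes "s \<in> sections" and "\<pi> x = 0" and "\<pi> y = 0"
  shows "transported_mult multA \<pi> s (act, \<theta>, mV) (s a + x) (s b + y) =
     s (multA a b) + (\<theta> a b + act a y + act b x + mV x y)"
  using assms split_section_iso[of s x a] split_section_iso[of s y b]
  by (simp add: transported_mult_split)

lemma linear_split:
  assumes "s \<in> sections"
  shows "Vector_Spaces.linear scaleE AE.scale (split s)"
  by unfold_locales
    (simp_all add: split_def AE.scale_def sectionD[OF assms] pi_simps pi.vs1.scale_right_diff_distrib)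

lemma linear_section_iso:
  assumes "s \<in> sections"
  shows "Vector_Spaces.linear AE.scale scaleE (section_iso s)"
  by unfold_locales
    (auto simp: AE.scale_def sectionD[OF assms] pi.vs1.scale_right_distrib)

lemma inj_split: "inj (split s)"
  by (rule inj_on_inverseI[where g = "section_iso s"]) (rule section_iso_split)

section \<open>From crossed systems to multiplications on E\<close>

lemma crossed_mult_in:
  assumes "(act, \<theta>, mV) \<in> CS" and "p \<in> UNIV \<times> Ker \<pi>" and "q \<in> UNIV \<times> Ker \<pi>"
  shows "crossed_mult multA (act, \<theta>, mV) p q \<in> UNIV \<times> Ker \<pi>"
proof -
  have "jj_algebra AE.scale (UNIV \<times> Ker \<pi>) (crossed_mult multA (act, \<theta>, mV))"
    using assms(1) by (simp add: crossed_systems_def)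
  then show ?thesis
    by (rule bilinear_onD(1)[OF jj_algebra.bilinear_mult]) (use assms in auto)
qed

lemma fst_crossed_mult: "fst (crossed_mult multA c p q) = multA (fst p) (fst q)"
  by (cases c; cases p; cases q) simp

text \<open>\<open>split s\<close> carries the transported product to the crossed product, so the
  axioms transfer. Its first coordinate is \<pi>, and first coordinates of a crossed product
  multiply by \<open>multA\<close>; hence \<pi> is multiplicative.\<close>

lemma transported_mult_in_structures:
  assumes c: "c \<in> CS" and s: "s \<in> sections"
  shows "transported_mult multA \<pi> s c \<in> structures"
proof -
  let ?m = "transported_mult multA \<pi> s c"
  obtain act \<theta> mV where c_eq: "c = (act, \<theta>, mV)" by (cases c)
  have jj: "jj_algebra AE.scale (UNIV \<times> Ker \<pi>) (crossed_mult multA c)"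
    using c by (simp add: c_eq crossed_systems_def)
  \<comment> \<open>\<open>split s\<close> undoes \<open>section_iso s\<close> on A x V, so the
    crossed product must first be known to stay there.\<close>
  have split_m: "split s (?m u v) = crossed_mult multA c (split s u) (split s v)" for u v
  proof -
    obtain a x where p: "crossed_mult multA c (split s u) (split s v) = (a, x)"
      by (meson surj_pair)
    with crossed_mult_in[OF c[unfolded c_eq] split_in[OF s, of u] split_in[OF s, of v]]
    have "\<pi> x = 0" by (simp add: c_eq)
    then show ?thesis
      unfolding transported_mult_split[OF s] p by (rule split_section_iso[OF s])
  qed
  have "jj_algebra scaleE UNIV ?m"
    by (rule jj_algebra_transfer[OF jj linear_split[OF s] pi.vs1.subspace_UNIV])
      (use split_in[OF s] inj_split split_m in auto)
  moreover have "\<pi> (?m u v) = multA (\<pi> u) (\<pi> v)" for u v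
    using arg_cong[OF split_m, of fst u v] by (simp add: fst_crossed_mult) (simp add: split_def)
  ultimately show ?thesis
    by (simp add: jj_structures_def jj_hom_def pi.linear_axioms)
qed

section \<open>From multiplications on E to crossed systems\<close>

text \<open>Expand \<open>m (s a + x) (s b + y)\<close>: the term \<open>s (multA a b)\<close>
  subtracted in the factor set cancels the one added by \<open>section_iso\<close>, and
  commutativity turns \<open>m x (s b)\<close> into the action of \<open>b\<close> on
  \<open>x\<close>.\<close>

lemma section_iso_crossed_mult_system_of:
  assumes m: "m \<in> structures" and s: "s \<in> sections"
    and "p \<in> UNIV \<times> Ker \<pi>" and "q \<in> UNIV \<times> Ker \<pi>"
  shows "section_iso s (crossed_mult multA (system_of s m) p q) = m (section_iso s p) (section_iso s q)"
proof -
  interpret m: jj_algebra scaleE UNIV m using m by (simp add: jj_structures_def)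
  note bil = bilinear_onD[OF m.bilinear_mult UNIV_I UNIV_I]
  obtain a x b y where "p = (a, x)" "q = (b, y)" "\<pi> x = 0" "\<pi> y = 0"
    using assms by auto
  then show ?thesis
    using m.mult_commute[of x "s b"] by (simp add: system_of_def bil algebra_simps)
qed

text \<open>The values lie in \<open>Ker \<pi>\<close> because \<pi> is multiplicative: products
  with an element of the kernel go to 0, and \<open>m (s a) (s b)\<close> and
  \<open>s (multA a b)\<close> both lie over \<open>multA a b\<close>.\<close>

lemma system_of_in_CS:
  assumes m: "m \<in> structures" and s: "s \<in> sections"
  shows "system_of s m \<in> CS"
proof -
  interpret m: jj_algebra scaleE UNIV m using m by (simp add: jj_structures_def)
  note bilA = bilinear_onD[OF A.bilinear_mult UNIV_I UNIV_I]
  note bil = bilinear_onD[OF m.bilinear_mult UNIV_I UNIV_I]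
  note zero = bilinear_on_zero[OF m.bilinear_mult] bilinear_on_zero[OF A.bilinear_mult]
  have pi_m: "\<pi> (m u v) = multA (\<pi> u) (\<pi> v)" for u v
    using m by (simp add: jj_structures_def jj_hom_def)
  note S = sectionD[OF s]
  obtain act \<theta> mV where c: "system_of s m = (act, \<theta>, mV)" by (cases "system_of s m")
  have act: "act = (\<lambda>a. \<lambda>x\<in>Ker \<pi>. m (s a) x)"
    and \<theta>: "\<theta> = (\<lambda>a b. m (s a) (s b) - s (multA a b))"
    and mV: "mV = (\<lambda>x\<in>Ker \<pi>. \<lambda>y\<in>Ker \<pi>. m x y)"
    using c by (auto simp: system_of_def)
  have act_ok: "act \<in> UNIV \<rightarrow>\<^sub>E Ker \<pi> \<rightarrow>\<^sub>E Ker \<pi>" "bilinear_on scaleA UNIV scaleE (Ker \<pi>) scaleE (Ker \<pi>) act"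
    unfolding act bilinear_on_def by (auto simp: pi_simps pi_m bil zero S split: if_splits)
  have \<theta>_ok: "\<theta> \<in> UNIV \<rightarrow>\<^sub>E UNIV \<rightarrow>\<^sub>E Ker \<pi>" "bilinear_on scaleA UNIV scaleA UNIV scaleE (Ker \<pi>) \<theta>"
    unfolding \<theta> bilinear_on_def
    by (auto simp: pi_simps pi_m bil bilA zero S pi.vs1.scale_right_diff_distrib)
  have mV_ok: "mV \<in> Ker \<pi> \<rightarrow>\<^sub>E Ker \<pi> \<rightarrow>\<^sub>E Ker \<pi>" "bilinear_on scaleE (Ker \<pi>) scaleE (Ker \<pi>) scaleE (Ker \<pi>) mV"
    unfolding mV bilinear_on_def by (auto simp: pi_simps pi_m bil zero S split: if_splits)
  \<comment> \<open>Here the axioms are pulled back from E to A x V along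
    \<open>section_iso s\<close>.\<close>
  have "jj_algebra AE.scale (UNIV \<times> Ker \<pi>) (crossed_mult multA (system_of s m))"
  proof (rule jj_algebra_transfer[OF m.jj_algebra_axioms linear_section_iso[OF s]
        AE.subspace_Times[OF A.subspace_UNIV subspace_Ker]])
    show "crossed_mult multA (system_of s m) p q \<in> UNIV \<times> Ker \<pi>"
      if "p \<in> UNIV \<times> Ker \<pi>" "q \<in> UNIV \<times> Ker \<pi>" for p q
      using that bilinear_onD(1)[OF act_ok(2)] bilinear_onD(1)[OF \<theta>_ok(2)] bilinear_onD(1)[OF mV_ok(2)]
      unfolding c by (auto simp: pi_simps)
  qed (use inj_on_section_iso[OF s] section_iso_crossed_mult_system_of[OF m s] in auto)
  then show ?thesis
    unfolding c crossed_systems_def using act_ok \<theta>_ok mV_ok by simp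
qed

text \<open>This is the source of surjectivity on classes.\<close>

lemma transported_mult_system_of:
  assumes "m \<in> structures" and s: "s \<in> sections"
  shows "transported_mult multA \<pi> s (system_of s m) = m"
  by (intro ext)
    (simp only: transported_mult_split[OF s] section_iso_split
      section_iso_crossed_mult_system_of[OF assms split_in[OF s] split_in[OF s]])

lemma structure_obtain_system:
  assumes "m \<in> structures" and "s \<in> sections"
  obtains c where "c \<in> CS" and "m = transported_mult multA \<pi> s c"
  using system_of_in_CS[OF assms] transported_mult_system_of[OF assms] by metis

section \<open>Comparison of the two cohomology relations\<close>

text \<open>
  Since the two sections may differ, this also yields the independence of the transported class
  from the chosen section.
\<close>

lemma transported_mult_ext_cohomologous_iff:
  assumes c: "c \<in> CS" and c': "c' \<in> CS" and s: "s \<in> sections" and s': "s' \<in> sections"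
  shows "(transported_mult multA \<pi> s c, transported_mult multA \<pi> s' c') \<in> ext_coh \<longleftrightarrow> (c, c') \<in> coh"
proof -
  obtain act \<theta> mV where c_eq: "c = (act, \<theta>, mV)" by (cases c)
  obtain act' \<theta>' mV' where c'_eq: "c' = (act', \<theta>', mV')" by (cases c')
  let ?m = "transported_mult multA \<pi> s c" and ?m' = "transported_mult multA \<pi> s' c'"
  note S = sectionD[OF s] and S' = sectionD[OF s']
  have mem: "?m \<in> structures" "?m' \<in> structures"
    using assms by (simp_all add: transported_mult_in_structures)
  have bil: "bilinear_on scaleA UNIV scaleE (Ker \<pi>) scaleE (Ker \<pi>) act"
    "bilinear_on scaleA UNIV scaleA UNIV scaleE (Ker \<pi>) \<theta>"
    "bilinear_on scaleE (Ker \<pi>) scaleE (Ker \<pi>) scaleE (Ker \<pi>) mV"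
    and extV: "mV \<in> Ker \<pi> \<rightarrow>\<^sub>E Ker \<pi> \<rightarrow>\<^sub>E Ker \<pi>"
    using c by (auto simp: c_eq crossed_systems_def)
  have bil': "bilinear_on scaleA UNIV scaleE (Ker \<pi>) scaleE (Ker \<pi>) act'"
    "bilinear_on scaleA UNIV scaleA UNIV scaleE (Ker \<pi>) \<theta>'"
    "bilinear_on scaleE (Ker \<pi>) scaleE (Ker \<pi>) scaleE (Ker \<pi>) mV'"
    and extV': "mV' \<in> Ker \<pi> \<rightarrow>\<^sub>E Ker \<pi> \<rightarrow>\<^sub>E Ker \<pi>"
    using c' by (auto simp: c'_eq crossed_systems_def)
  note in_Ker = bilinear_onD(1)[OF bil(1), simplified] bilinear_onD(1)[OF bil(2), simplified]
    bilinear_onD(1)[OF bil(3), simplified]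
  note add' = bilinear_onD(3)[OF bil'(1), simplified] bilinear_onD(2,3)[OF bil'(3), simplified]
  note zero = bilinear_on_zero[OF bil(1), simplified] bilinear_on_zero[OF bil(2), simplified]
    bilinear_on_zero[OF bil(3), simplified]
  note zero' = bilinear_on_zero[OF bil'(1), simplified] bilinear_on_zero[OF bil'(2), simplified]
    bilinear_on_zero[OF bil'(3), simplified]
  note zeroA = bilinear_on_zero[OF A.bilinear_mult, simplified]
  note m_eq = transported_mult_section_iso[OF s, of _ _ act \<theta> mV, folded c_eq]
  note m'_eq = transported_mult_section_iso[OF s', of _ _ act' \<theta>' mV', folded c'_eq]
  show ?thesis
  proof
    assume "(?m, ?m') \<in> ext_coh"
    then obtain \<phi> where "jj_hom scaleE ?m scaleE ?m' \<phi>" and phi_V: "\<And>x. \<pi> x = 0 \<Longrightarrow> \<phi> x = x"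
      and "\<pi> \<circ> \<phi> = \<pi>"
      by (auto simp: ext_cohomologous_def)
    then have lin: "Vector_Spaces.linear scaleE scaleE \<phi>"
      and hom: "\<And>u v. \<phi> (?m u v) = ?m' (\<phi> u) (\<phi> v)" and pi_phi: "\<And>u. \<pi> (\<phi> u) = \<pi> u"
      by (auto simp: jj_hom_def fun_eq_iff)
    interpret \<phi>: Vector_Spaces.linear scaleE scaleE \<phi> by (rule lin)
    \<comment> \<open>\<phi> lies over A, so \<open>\<phi> (s a)\<close> and \<open>s' a\<close>
      have the same image under \<pi> and differ by an element of V.\<close>
    define r where "r a = \<phi> (s a) - s' a" for a
    have r: "\<pi> (r a) = 0" for a by (simp add: r_def pi.diff pi_phi S S')
    have r_lin: "Vector_Spaces.linear scaleA scaleE r"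
      by unfold_locales
        (simp_all add: r_def S S' \<phi>.add \<phi>.scale pi.vs1.scale_right_diff_distrib)
    have r0: "r 0 = 0" by (simp add: r_def S S' \<phi>.zero)
    have phi_eq: "\<phi> (s a + x) = s' a + (r a + x)" if "\<pi> x = 0" for a x
      by (simp add: r_def \<phi>.add phi_V that)
    \<comment> \<open>Multiplicativity of \<phi> on general elements, with
      \<open>s' (multA a b)\<close> cancelled. All three conditions are specializations:
      \<open>a = b = 0\<close> compares the products on V, \<open>x = b = 0\<close> the actions,
      \<open>x = y = 0\<close> the factor sets.\<close>
    have key: "r (multA a b) + (\<theta> a b + act a y + act b x + mV x y) =
        \<theta>' a b + act' a (r b + y) + act' b (r a + x) + mV' (r a + x) (r b + y)"
      if xy: "\<pi> x = 0" "\<pi> y = 0" for a b x y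
      using hom[of "s a + x" "s b + y"]
      by (simp add: m_eq m'_eq phi_eq xy in_Ker pi_simps r)
    have "mV x y = mV' x y" if "\<pi> x = 0" "\<pi> y = 0" for x y
      using key[OF that, of 0 0] by (simp add: zero zero' zeroA r0 that)
    \<comment> \<open>Agreement on V gives equality of functions since both are extensional in each
      argument.\<close>
    then have "mV = mV'"
      by (intro PiE_ext[OF extV extV'] PiE_ext[OF PiE_mem[OF extV] PiE_mem[OF extV']]) auto
    moreover have "act a y = act' a y + mV' (r a) y" if "\<pi> y = 0" for a y
      using key[of 0 y a 0] that by (simp add: zero zero' zeroA r0 r add' pi.zero)
    moreover have "\<theta> a b = \<theta>' a b + act' a (r b) + act' b (r a) + mV' (r a) (r b) - r (multA a b)"
      for a b
      using key[of 0 0 a b] by (simp add: zero zero' pi.zero r algebra_simps)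
    ultimately show "(c, c') \<in> coh"
      using c c' r r_lin unfolding c_eq c'_eq cohomologous_def by blast
  next
    assume "(c, c') \<in> coh"
    then obtain r where "mV = mV'" and r_lin: "Vector_Spaces.linear scaleA scaleE r"
      and r: "\<And>a. \<pi> (r a) = 0"
      and act: "\<And>a x. \<pi> x = 0 \<Longrightarrow> act a x = act' a x + mV' (r a) x"
      and \<theta>: "\<And>a b. \<theta> a b = \<theta>' a b + act' a (r b) + act' b (r a) + mV' (r a) (r b) - r (multA a b)"
      by (auto simp: c_eq c'_eq cohomologous_def)
    interpret r: Vector_Spaces.linear scaleA scaleE r by (rule r_lin)
    \<comment> \<open>The map sending \<open>s a + x\<close> to \<open>s' a + r a + x\<close>,
      written with \<open>a = \<pi> u\<close> and \<open>x = u - s a\<close>.\<close>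
    define \<phi> where "\<phi> u = s' (\<pi> u) + (r (\<pi> u) + (u - s (\<pi> u)))" for u
    have lin: "Vector_Spaces.linear scaleE scaleE \<phi>"
      by unfold_locales
        (simp_all add: \<phi>_def S S' pi_simps r.add r.scale pi.vs1.scale_right_distrib
          pi.vs1.scale_right_diff_distrib algebra_simps)
    have phi_eq: "\<phi> (s a + x) = s' a + (r a + x)" if "\<pi> x = 0" for a x
      using that by (simp add: \<phi>_def S pi.add)
    \<comment> \<open>On V the transported product is \<open>mV'\<close>, because
      \<open>s' 0 = 0\<close>. Commutativity is needed below: expanding the product yields
      \<open>mV' x (r b)\<close>, while the action of \<open>b\<close> on \<open>x\<close>
      contributes \<open>mV' (r b) x\<close>.\<close>
    have comm: "mV' x y = mV' y x" if "\<pi> x = 0" "\<pi> y = 0" for x y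
    proof -
      interpret m': jj_algebra scaleE UNIV ?m' using mem by (simp add: jj_structures_def)
      show ?thesis
        using m'.mult_commute[of "s' 0 + x" "s' 0 + y"]
        by (simp add: m'_eq that zero')
    qed
    have "\<phi> (?m u v) = ?m' (\<phi> u) (\<phi> v)" for u v
    proof -
      define a x b y where "a = \<pi> u" and "x = u - s a" and "b = \<pi> v" and "y = v - s b"
      have xy: "\<pi> x = 0" "\<pi> y = 0" and uv: "u = s a + x" "v = s b + y"
        by (simp_all add: a_def x_def b_def y_def pi.diff S)
      have "\<pi> (\<theta> a b + act a y + act b x + mV x y) = 0"
        by (simp add: pi_simps in_Ker xy)
      then have "\<phi> (?m u v) = s' (multA a b) + (r (multA a b) + (\<theta> a b + act a y + act b x + mV x y))"
        unfolding uv m_eq[OF xy] by (rule phi_eq)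
      also have "\<dots> = ?m' (\<phi> u) (\<phi> v)"
        unfolding uv
        by (simp add: m'_eq phi_eq xy pi_simps r add' act \<theta> \<open>mV = mV'\<close> comm[OF xy(1) r])
      finally show ?thesis .
    qed
    moreover have "\<phi> x = x" if "\<pi> x = 0" for x
      by (simp add: \<phi>_def that S S' r.zero)
    moreover have "\<pi> (\<phi> u) = \<pi> u" for u
      by (simp add: \<phi>_def S S' pi_simps r)
    ultimately show "(?m, ?m') \<in> ext_coh"
      using mem lin by (auto simp: ext_cohomologous_def jj_hom_def fun_eq_iff)
  qed
qed

section \<open>The two equivalence relations\<close>

text \<open>Identity and composition give reflexivity and transitivity. For symmetry, a morphism
  that fixes V and lies over A is shown to be bijective.\<close>

lemma equiv_ext_coh: "equiv structures ext_coh"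
proof (rule equivI)
  show "ext_coh \<subseteq> structures \<times> structures"
    by (auto simp: ext_cohomologous_def)
  show "refl_on structures ext_coh"
    by (auto simp: refl_on_def ext_cohomologous_def jj_hom_def
        intro!: exI[where x = id] pi.vs1.linear_id)
  show "trans ext_coh"
  proof (rule transI)
    fix m1 m2 m3
    assume "(m1, m2) \<in> ext_coh" and "(m2, m3) \<in> ext_coh"
    then obtain \<phi> \<psi> where mem: "m1 \<in> structures" "m3 \<in> structures"
      and \<phi>: "jj_hom scaleE m1 scaleE m2 \<phi>" "\<forall>x\<in>Ker \<pi>. \<phi> x = x" "\<pi> \<circ> \<phi> = \<pi>"
      and \<psi>: "jj_hom scaleE m2 scaleE m3 \<psi>" "\<forall>x\<in>Ker \<pi>. \<psi> x = x" "\<pi> \<circ> \<psi> = \<pi>"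
      unfolding ext_cohomologous_def by blast
    have "jj_hom scaleE m1 scaleE m3 (\<psi> \<circ> \<phi>)"
      using \<phi>(1) \<psi>(1) by (auto simp: jj_hom_def intro: Vector_Spaces.linear_compose)
    moreover have "\<forall>x\<in>Ker \<pi>. (\<psi> \<circ> \<phi>) x = x" "\<pi> \<circ> (\<psi> \<circ> \<phi>) = \<pi>"
      using \<phi>(2,3) \<psi>(2,3) by (simp_all add: fun_eq_iff)
    ultimately show "(m1, m3) \<in> ext_coh"
      using mem unfolding ext_cohomologous_def by blast
  qed
  show "sym ext_coh"
  proof (rule symI)
    fix m m'
    assume "(m, m') \<in> ext_coh"
    then obtain \<phi> where mem: "m \<in> structures" "m' \<in> structures"
      and "jj_hom scaleE m scaleE m' \<phi>" and phi_V: "\<And>x. \<pi> x = 0 \<Longrightarrow> \<phi> x = x" and "\<pi> \<circ> \<phi> = \<pi>"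
      by (auto simp: ext_cohomologous_def)
    then have lin: "Vector_Spaces.linear scaleE scaleE \<phi>"
      and hom: "\<And>u v. \<phi> (m u v) = m' (\<phi> u) (\<phi> v)" and pi_phi: "\<And>u. \<pi> (\<phi> u) = \<pi> u"
      by (auto simp: jj_hom_def fun_eq_iff)
    interpret \<phi>: Vector_Spaces.linear scaleE scaleE \<phi> by (rule lin)
    \<comment> \<open>\<open>\<phi> - id\<close> takes values in \<open>Ker \<pi>\<close> and vanishes there, so \<open>id - (\<phi> - id)\<close> inverts \<open>\<phi>\<close>.\<close>
    define \<psi> where "\<psi> u = u - (\<phi> u - u)" for u
    have phi_phi: "\<phi> (\<phi> u - u) = \<phi> u - u" for u
      by (rule phi_V) (simp add: pi.diff pi_phi)
    have \<phi>\<psi>: "\<phi> (\<psi> u) = u" and \<psi>\<phi>: "\<psi> (\<phi> u) = u" for u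
      using phi_phi[of u] by (simp_all add: \<psi>_def \<phi>.diff \<phi>.add algebra_simps)
    have "Vector_Spaces.linear scaleE scaleE \<psi>"
      by unfold_locales
        (simp_all add: \<psi>_def \<phi>.add \<phi>.scale pi.vs1.scale_right_diff_distrib algebra_simps)
    \<comment> \<open>The inverse of a multiplicative bijection is multiplicative: write
      \<open>u\<close> and \<open>v\<close> as images under \<phi>.\<close>
    moreover have "\<psi> (m' u v) = m (\<psi> u) (\<psi> v)" for u v
      by (metis \<phi>\<psi> \<psi>\<phi> hom)
    moreover have "\<psi> x = x" if "\<pi> x = 0" for x
      by (simp add: \<psi>_def phi_V that)
    moreover have "\<pi> (\<psi> u) = \<pi> u" for u
      by (simp add: \<psi>_def pi.diff pi_phi)
    ultimately show "(m', m) \<in> ext_coh"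
      using mem by (auto simp: ext_cohomologous_def jj_hom_def fun_eq_iff)
  qed
qed

text \<open>With one fixed section on both sides, \<open>coh\<close> says that two systems have the
  same class of transported products, and equality of values of a function is an
  equivalence.\<close>

lemma equiv_coh: "equiv CS coh"
proof -
  obtain s where s: "s \<in> sections" using sections_nonempty by blast
  have sub: "coh \<subseteq> CS \<times> CS" by (auto simp: cohomologous_def)
  have "coh = {(c, c'). c \<in> CS \<and> c' \<in> CS \<and>
      ext_coh `` {transported_mult multA \<pi> s c} = ext_coh `` {transported_mult multA \<pi> s c'}}"
    using sub transported_mult_ext_cohomologous_iff[OF _ _ s s]
      eq_equiv_class_iff[OF equiv_ext_coh] transported_mult_in_structures[OF _ s]
    by blast
  then show ?thesis
    by (auto intro!: equivI simp: refl_on_def sym_def trans_def)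
qed

section \<open>The map on classes and its bijectivity\<close>

text \<open>Well-definedness: every representative and every section contribute the same class to
  the union, and the pair \<open>c\<close>, \<open>s\<close> itself occurs in it.\<close>

lemma GH2_to_Gext_class:
  assumes c: "c \<in> CS" and s: "s \<in> sections"
  shows "GH2_to_Gext scaleA multA scaleE \<pi> (coh `` {c}) = ext_coh `` {transported_mult multA \<pi> s c}"
proof -
  have "ext_coh `` {transported_mult multA \<pi> s' c'} = ext_coh `` {transported_mult multA \<pi> s c}"
    if "c' \<in> coh `` {c}" and s': "s' \<in> sections" for c' s'
  proof -
    have "(c, c') \<in> coh" "c' \<in> CS" using that by (auto simp: cohomologous_def)
    then show ?thesis
      using equiv_class_eq[OF equiv_ext_coh, symmetric] transported_mult_ext_cohomologous_iff[OF c _ s s'] by blast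
  qed
  moreover have "c \<in> coh `` {c}" using equiv_class_self[OF equiv_coh c] .
  ultimately show ?thesis
    using s unfolding GH2_to_Gext_def by blast
qed

text \<open>All values are computed with one fixed section. Injectivity is the implication from
  \<open>ext_coh\<close> back to \<open>coh\<close>; surjectivity holds because every admissible
  product on E is transported from a crossed system.\<close>

lemma bij_betw_GH2_to_Gext:
  "bij_betw (GH2_to_Gext scaleA multA scaleE \<pi>)
     (GH2 scaleA multA scaleE (Ker \<pi>)) (Gext scaleA multA scaleE \<pi>)"
proof -
  obtain s where s: "s \<in> sections" using sections_nonempty by blast
  let ?F = "GH2_to_Gext scaleA multA scaleE \<pi>"
  note F = GH2_to_Gext_class[OF _ s]
  have "inj_on ?F (CS // coh)"
  proof (rule inj_onI, elim quotientE)
    fix X Y c c'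
    assume eq: "?F X = ?F Y" and c: "c \<in> CS" "c' \<in> CS" and X: "X = coh `` {c}" "Y = coh `` {c'}"
    then have "(transported_mult multA \<pi> s c, transported_mult multA \<pi> s c') \<in> ext_coh"
      using eq_equiv_class_iff[OF equiv_ext_coh] transported_mult_in_structures[OF _ s]
      by (simp add: F)
    then show "X = Y"
      using equiv_class_eq[OF equiv_coh] transported_mult_ext_cohomologous_iff[OF c s s] X by simp
  qed
  moreover have "?F ` (CS // coh) = structures // ext_coh"
  proof (intro equalityI subsetI)
    fix Y
    assume "Y \<in> ?F ` (CS // coh)"
    then show "Y \<in> structures // ext_coh"
      by (auto elim!: quotientE simp: F intro!: quotientI transported_mult_in_structures s)
  next
    fix Y
    assume "Y \<in> structures // ext_coh"
    then obtain m where "m \<in> structures" and Y: "Y = ext_coh `` {m}"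
      by (rule quotientE)
    then obtain c where c: "c \<in> CS" "m = transported_mult multA \<pi> s c"
      using structure_obtain_system s by blast
    then have "Y = ?F (coh `` {c})" by (simp add: F Y)
    then show "Y \<in> ?F ` (CS // coh)" using quotientI[OF c(1)] by blast
  qed
  ultimately show ?thesis
    by (simp add: bij_betw_def GH2_def Gext_def)
qed

end

theorem theorem2p8:
  fixes scaleA :: "'k::field \<Rightarrow> 'a::ab_group_add \<Rightarrow> 'a"
    and scaleE :: "'k \<Rightarrow> 'e::ab_group_add \<Rightarrow> 'e"
    and multA :: "'a \<Rightarrow> 'a \<Rightarrow> 'a"
    and \<pi> :: "'e \<Rightarrow> 'a"
    and V :: "'e set"
  assumes "jj_algebra scaleA UNIV multA"
    and "vector_space scaleE"
    and "Vector_Spaces.linear scaleE scaleA \<pi>"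
    and "surj \<pi>"
    and "V = Ker \<pi>"
  shows "equiv (crossed_systems scaleA multA scaleE V) (cohomologous scaleA multA scaleE V)
    \<and> (\<forall>c \<in> crossed_systems scaleA multA scaleE V. \<forall>s \<in> linear_sections scaleA scaleE \<pi>.
         GH2_to_Gext scaleA multA scaleE \<pi> (cohomologous scaleA multA scaleE V `` {c}) =
           ext_cohomologous scaleA multA scaleE \<pi> `` {transported_mult multA \<pi> s c})
    \<and> bij_betw (GH2_to_Gext scaleA multA scaleE \<pi>)
        (GH2 scaleA multA scaleE V) (Gext scaleA multA scaleE \<pi>)"
proof -
  interpret epimorphism_onto_jj_algebra scaleA multA scaleE \<pi>
    using assms by (simp add: epimorphism_onto_jj_algebra_def epimorphism_onto_jj_algebra_axioms_def)
  show ?thesis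
    unfolding \<open>V = Ker \<pi>\<close>
    using equiv_coh GH2_to_Gext_class bij_betw_GH2_to_Gext by blast
qed

end
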